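(* Let $A$ be a unital $C^*$-algebra and let $a,b\in A$ satisfy $ab=ba$. Suppose $a$ is similar to a strict contraction and $b$ is similar to a contraction. Then there is an invertible $c\in A$ such that $$\|cac^{-1}\|\le1,\qquad\|cbc^{-1}\|\le1.$$
   Context: An element $x\in A$ is similar to a contraction if there is an invertible $s\in A$ with $\|sxs^{-1}\|\le1$, and similar to a strict contraction if there is an invertible $s\in A$ with $\|sxs^{-1}\|<1$. *)

theory Defs
  imports Complex_Main
begin

text \<open>
  The zero algebra is admitted: the unit comes from \<^class>\<open>monoid_mult\<close> rather than from
  \<^class>\<open>real_normed_algebra_1\<close>, since the latter requires \<open>0 \<noteq> 1\<close>.  In a nonzero algebra
  \<open>norm 1 = 1\<close> follows from the C*-identity.
\<close>

class unital_cstar_algebra = real_normed_algebra + monoid_mult + banach +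
  fixes scaleC :: "complex \<Rightarrow> 'a \<Rightarrow> 'a" (infixr "*\<^sub>C" 75)
    and star :: "'a \<Rightarrow> 'a"
  assumes scaleC_of_real: "complex_of_real r *\<^sub>C x = r *\<^sub>R x"
    and scaleC_add_right: "z *\<^sub>C (x + y) = z *\<^sub>C x + z *\<^sub>C y"
    and scaleC_add_left: "(z + w) *\<^sub>C x = z *\<^sub>C x + w *\<^sub>C x"
    and scaleC_scaleC: "z *\<^sub>C (w *\<^sub>C x) = (z * w) *\<^sub>C x"
    and mult_scaleC_left: "(z *\<^sub>C x) * y = z *\<^sub>C (x * y)"
    and mult_scaleC_right: "x * (z *\<^sub>C y) = z *\<^sub>C (x * y)"
    and norm_scaleC: "norm (z *\<^sub>C x) = cmod z * norm x"
    and star_add: "star (x + y) = star x + star y"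
    and star_scaleC: "star (z *\<^sub>C x) = cnj z *\<^sub>C star x"
    and star_mult: "star (x * y) = star y * star x"
    and star_star: "star (star x) = x"
    and cstar_identity: "norm (star x * x) = (norm x)\<^sup>2"

definition mutually_inverse :: "'a::monoid_mult \<Rightarrow> 'a \<Rightarrow> bool" where
  "mutually_inverse s t \<longleftrightarrow> s * t = 1 \<and> t * s = 1"

definition similar_to_contraction :: "'a::unital_cstar_algebra \<Rightarrow> bool" where
  "similar_to_contraction x \<longleftrightarrow> (\<exists>s t. mutually_inverse s t \<and> norm (s * x * t) \<le> 1)"

definition similar_to_strict_contraction :: "'a::unital_cstar_algebra \<Rightarrow> bool" where
  "similar_to_strict_contraction x \<longleftrightarrow> (\<exists>s t. mutually_inverse s t \<and> norm (s * x * t) < 1)"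

end

theory Submission
  imports Defs "HOL-Computational_Algebra.Formal_Power_Series"
begin

text \<open>
  Replacing \<open>a\<close> and \<open>b\<close> by \<open>s * a * t\<close> and \<open>s * b * t\<close>, where \<open>s\<close> and its inverse \<open>t\<close> make
  \<open>b\<close> a contraction, one may assume \<open>norm b \<le> 1\<close>.  Since \<open>a\<close> is similar to a strict
  contraction, its powers tend to \<open>0\<close>, so \<open>norm (a ^ N) \<le> 1\<close> for some \<open>N > 0\<close>.  Put
  \<open>p = (\<Sum>n<N. star (a ^ n) * a ^ n)\<close>.  The sum telescopes to
  \<open>p - star a * p * a = 1 - star (a ^ N) * a ^ N \<ge> 0\<close>, and because \<open>a\<close> and \<open>b\<close> commute,
  \<open>p - star b * p * b = (\<Sum>n<N. star (a ^ n) * (1 - star b * b) * a ^ n) \<ge> 0\<close>.  The term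
  \<open>n = 0\<close> gives \<open>p \<ge> 1\<close>, so \<open>p = c * c\<close> with \<open>c\<close> self-adjoint and invertible, and the two
  inequalities say that conjugation by \<open>c\<close> makes both \<open>a\<close> and \<open>b\<close> contractions
  (\<open>simultaneous_contraction\<close>).

  This uses the order of a C*-algebra: square roots, closure of the positive elements under
  sums, and positivity of \<open>star x * x\<close>.  These are derived without spectra or functional calculus.
  An element is called positive if it is the square of a self-adjoint one.  The binomial series of
  \<open>sqrt (1 - y)\<close> converges absolutely on the closed unit ball, so a self-adjoint \<open>x\<close> with
  \<open>norm (t *\<^sub>R 1 - x) \<le> t\<close> is positive.  Conversely, if \<open>h\<close> is self-adjoint of norm at most \<open>1\<close>
  and \<open>k\<close> is the root of \<open>1 - h * h\<close>, then \<open>h + \<i> *\<^sub>C k\<close> is unitary, and the real part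
  \<open>2 *\<^sub>R (h * h) - 1\<close> of its square has norm at most \<open>1\<close>; hence positive elements satisfy the norm
  criterion (\<open>positive_norm_bound\<close>).  The criterion makes the positive elements a closed cone.
  For \<open>star x * x\<close> (\<open>positive_star_mult\<close>), a lower bound \<open>- m\<close> for both \<open>star x * x\<close> and
  \<open>x * star x\<close> improves to \<open>- r / 2\<close> for every positive \<open>r > m\<close>, and iteration brings the bound to \<open>0\<close>.
\<close>

section \<open>Adjoints and norms\<close>

lemma star_one: "star (1::'a::unital_cstar_algebra) = 1"
  by (metis mult_1_right star_mult star_star)

lemma star_scaleR: "star (r *\<^sub>R x) = r *\<^sub>R star (x::'a::unital_cstar_algebra)"
  by (metis complex_cnj_complex_of_real scaleC_of_real star_scaleC)

lemma star_zero: "star (0::'a::unital_cstar_algebra) = 0"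
  using star_scaleR[of 0 0] by simp

lemma star_minus: "star (- x) = - star (x::'a::unital_cstar_algebra)"
  using star_scaleR[of "-1" x] by simp

lemma star_diff: "star (x - y) = star x - star (y::'a::unital_cstar_algebra)"
  using star_add[of x "- y"] by (simp add: star_minus)

lemma star_power: "star (x ^ n) = star (x::'a::unital_cstar_algebra) ^ n"
  by (induction n) (simp_all add: star_one star_mult power_commutes)

lemma norm_star: "norm (star x) = norm (x::'a::unital_cstar_algebra)"
proof -
  have le: "norm y \<le> norm (star y)" for y :: 'a
  proof (cases "norm y = 0")
    case False
    have "norm y * norm y \<le> norm (star y) * norm y"
      using cstar_identity[of y] norm_mult_ineq[of "star y" y] by (simp add: power2_eq_square)
    with False show ?thesis by simp
  qed simp
  show ?thesis using le[of x] le[of "star x"] by (simp add: star_star)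
qed

lemma bounded_linear_star: "bounded_linear (star :: 'a::unital_cstar_algebra \<Rightarrow> 'a)"
  by (rule bounded_linear_intro[where K = 1]) (simp_all add: star_add star_scaleR norm_star)

text \<open>
  The C*-identity leaves the values \<open>0\<close> and \<open>1\<close> for \<open>norm 1\<close>; the value \<open>0\<close> occurs in the zero
  algebra.
\<close>

lemma norm_one_le: "norm (1::'a::unital_cstar_algebra) \<le> 1"
proof -
  have "norm (1::'a) = (norm (1::'a))\<^sup>2"
    using cstar_identity[of "1::'a"] by (simp add: star_one)
  then have "norm (1::'a) = 0 \<or> norm (1::'a) = 1" by (simp add: power2_eq_square)
  then show ?thesis by auto
qed

lemma norm_power_le: "norm (x ^ n) \<le> norm (x::'a::unital_cstar_algebra) ^ n"
proof (induction n)
  case (Suc n)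
  then show ?case
    using norm_mult_ineq[of x "x ^ n"] mult_left_mono[OF Suc norm_ge_zero[of x]] by simp
qed (simp add: norm_one_le)

lemma norm_isometry_le_one:
  fixes u :: "'a::unital_cstar_algebra"
  assumes "star u * u = 1"
  shows "norm u \<le> 1"
proof -
  have "(norm u)\<^sup>2 \<le> 1\<^sup>2" using cstar_identity[of u] assms norm_one_le[where 'a='a] by simp
  then show ?thesis by (rule power2_le_imp_le) simp
qed

section \<open>Square roots by the binomial series\<close>

text \<open>The Taylor coefficients at \<open>0\<close> of \<open>\<lambda>y. sqrt (1 - y)\<close>.\<close>

definition sqrt_coeff :: "nat \<Rightarrow> real" where
  "sqrt_coeff n = (- 1) ^ n * (1/2 gchoose n)"

lemma sqrt_coeff_0: "sqrt_coeff 0 = 1"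
  by (simp add: sqrt_coeff_def)

lemma sqrt_coeff_Suc: "real (Suc n) * sqrt_coeff (Suc n) = (real n - 1/2) * sqrt_coeff n"
proof -
  have "real (Suc n) * (1/2 gchoose (Suc n)) = (1/2 - real n) * ((1/2::real) gchoose n)"
    using gbinomial_mult_1[of "1/2::real" n] by (simp add: algebra_simps)
  then have "(- 1) ^ n * (real (Suc n) * (1/2 gchoose (Suc n)))
      = (- 1) ^ n * ((1/2 - real n) * ((1/2::real) gchoose n))" by (rule arg_cong)
  then show ?thesis
    unfolding sqrt_coeff_def by (simp add: algebra_simps)
qed

lemma sqrt_coeff_nonpos: "sqrt_coeff (Suc n) \<le> 0"
proof (induction n)
  case 0
  then show ?case using sqrt_coeff_Suc[of 0] by (simp add: sqrt_coeff_0)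
next
  case (Suc n)
  have "real (Suc (Suc n)) * sqrt_coeff (Suc (Suc n)) \<le> 0"
    unfolding sqrt_coeff_Suc[of "Suc n"] using Suc by (simp add: mult_nonneg_nonpos)
  then show ?case by (simp only: mult_le_0_iff) simp
qed

text \<open>
  The partial sums telescope by the recursion \<open>sqrt_coeff_Suc\<close>.  This form shows that they are
  nonnegative, which bounds the sum of the absolute values, since only the zeroth coefficient is
  positive.
\<close>

lemma sum_sqrt_coeff: "(\<Sum>k<Suc n. sqrt_coeff k) = - 2 * real (Suc n) * sqrt_coeff (Suc n)"
proof (induction n)
  case 0
  then show ?case using sqrt_coeff_Suc[of 0] by (simp add: sqrt_coeff_0)
next
  case (Suc n)
  have "(\<Sum>k<Suc (Suc n). sqrt_coeff k)
      = - 2 * real (Suc n) * sqrt_coeff (Suc n) + sqrt_coeff (Suc n)"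
    using Suc by simp
  also have "\<dots> = - 2 * (real (Suc (Suc n)) * sqrt_coeff (Suc (Suc n)))"
    unfolding sqrt_coeff_Suc[of "Suc n"] by (simp add: algebra_simps)
  finally show ?case by (simp only: mult.assoc)
qed

lemma summable_abs_sqrt_coeff: "summable (\<lambda>n. \<bar>sqrt_coeff n\<bar>)"
proof (rule summableI_nonneg_bounded)
  fix n
  have "(\<Sum>i<Suc n. \<bar>sqrt_coeff i\<bar>) = 2 - (\<Sum>i<Suc n. sqrt_coeff i)" for n
    by (induction n) (simp_all add: sqrt_coeff_0 sqrt_coeff_nonpos abs_of_nonpos)
  moreover have "(\<Sum>i<Suc n. sqrt_coeff i) \<ge> 0" for n
    unfolding sum_sqrt_coeff using sqrt_coeff_nonpos[of n]
    by (intro mult_nonpos_nonpos) simp_all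
  ultimately have "(\<Sum>i<Suc n. \<bar>sqrt_coeff i\<bar>) \<le> 2"
    by (metis diff_ge_0_iff_ge diff_diff_eq2 add_diff_cancel_left')
  then show "(\<Sum>i<n. \<bar>sqrt_coeff i\<bar>) \<le> 2" by simp
qed simp

text \<open>
  The formal identity \<open>sqrt (1 - y) * sqrt (1 - y) = 1 - y\<close>, an instance of the Vandermonde
  convolution.
\<close>

lemma sqrt_coeff_convolution:
  "(\<Sum>i\<le>n. sqrt_coeff i * sqrt_coeff (n - i)) = (if n = 0 then 1 else if n = 1 then - 1 else 0)"
proof -
  have "(\<Sum>i\<le>n. sqrt_coeff i * sqrt_coeff (n - i))
      = (\<Sum>i=0..n. (- 1) ^ n * ((1/2 gchoose i) * (1/2 gchoose (n - i))))"
    unfolding atLeast0AtMost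
  proof (rule sum.cong)
    fix i assume "i \<in> {..n}"
    then have "(- 1::real) ^ n = (- 1) ^ i * (- 1) ^ (n - i)" by (simp flip: power_add)
    then show "sqrt_coeff i * sqrt_coeff (n - i)
        = (- 1) ^ n * ((1/2 gchoose i) * (1/2 gchoose (n - i)))"
      by (simp add: sqrt_coeff_def)
  qed simp
  also have "\<dots> = (- 1) ^ n * (((1/2::real) + 1/2) gchoose n)"
    by (simp only: sum_distrib_left[symmetric] gbinomial_Vandermonde)
  also have "\<dots> = (- 1) ^ n * real (1 choose n)"
    by (simp add: binomial_gbinomial)
  also have "\<dots> = (if n = 0 then 1 else if n = 1 then - 1 else 0)"
    by (cases n; cases "n - 1") (auto simp: binomial_eq_0)
  finally show ?thesis .
qed

text \<open>
  The root is a limit of polynomials in \<open>y\<close>; this gives both self-adjointness and the commutation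
  with everything that commutes with \<open>y\<close>.  The boundary case \<open>norm y = 1\<close>, covered because the
  coefficients are absolutely summable, is what makes the positive elements closed.
\<close>

lemma exists_sqrt_one_minus:
  fixes y :: "'a::unital_cstar_algebra"
  assumes sa: "star y = y" and le: "norm y \<le> 1"
  shows "\<exists>w. star w = w \<and> w * w = 1 - y \<and> (\<forall>z. z * y = y * z \<longrightarrow> z * w = w * z)"
proof -
  define f where "f n = sqrt_coeff n *\<^sub>R y ^ n" for n
  define w where "w = suminf f"
  have bound: "norm (f n) \<le> \<bar>sqrt_coeff n\<bar>" for n
    using mult_left_mono[of "norm (y ^ n)" 1 "\<bar>sqrt_coeff n\<bar>"] norm_power_le[of y n]
      power_le_one[OF norm_ge_zero le, of n]
    by (simp add: f_def)
  have sn: "summable (\<lambda>n. norm (f n))"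
    using summable_abs_sqrt_coeff by (rule summable_comparison_test') (simp add: bound)
  then have sf: "summable f" by (rule summable_norm_cancel)
  have "star w = (\<Sum>n. star (f n))"
    unfolding w_def by (rule bounded_linear.suminf[OF bounded_linear_star sf])
  also have "\<dots> = w"
  proof -
    have "star (f n) = f n" for n by (simp add: f_def star_scaleR star_power sa)
    then show ?thesis by (simp add: w_def)
  qed
  finally have 1: "star w = w" .
  have conv: "(\<Sum>i\<le>n. f i * f (n - i))
      = (if n = 0 then 1 else if n = 1 then - 1 else 0) *\<^sub>R y ^ n" for n
  proof -
    have "(\<Sum>i\<le>n. f i * f (n - i)) = (\<Sum>i\<le>n. (sqrt_coeff i * sqrt_coeff (n - i)) *\<^sub>R y ^ n)"
      by (rule sum.cong) (simp_all add: f_def flip: power_add)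
    then show ?thesis
      by (simp only: scaleR_sum_left[symmetric] sqrt_coeff_convolution)
  qed
  have "w * w = (\<Sum>n. \<Sum>i\<le>n. f i * f (n - i))"
    unfolding w_def by (rule Cauchy_product[OF sn sn])
  also have "\<dots> = (\<Sum>n\<in>{0,1}. \<Sum>i\<le>n. f i * f (n - i))"
    by (rule suminf_finite) (simp_all add: conv)
  also have "\<dots> = 1 - y" unfolding conv by simp
  finally have 2: "w * w = 1 - y" .
  have 3: "z * w = w * z" if zy: "z * y = y * z" for z
  proof -
    have "z * y ^ n = y ^ n * z" for n
      by (induction n) (simp_all, metis mult.assoc zy)
    then show ?thesis
      unfolding w_def by (simp add: suminf_mult[OF sf, symmetric] suminf_mult2[OF sf] f_def)
  qed
  from 1 2 3 show ?thesis by blast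
qed

lemma exists_sqrt:
  fixes x :: "'a::unital_cstar_algebra"
  assumes sa: "star x = x" and le: "norm (t *\<^sub>R 1 - x) \<le> t"
  shows "\<exists>w. star w = w \<and> w * w = x \<and> (\<forall>z. z * x = x * z \<longrightarrow> z * w = w * z)"
proof (cases "t = 0")
  case True
  then have "x = 0" using le by simp
  then show ?thesis by (intro exI[of _ 0]) (simp add: star_zero)
next
  case False
  then have t: "t > 0" using le norm_ge_zero[of "t *\<^sub>R 1 - x"] by linarith
  define y where "y = 1 - (1/t) *\<^sub>R x"
  have "(1/t) *\<^sub>R (t *\<^sub>R 1 - x) = y" using t by (simp add: y_def algebra_simps)
  then have "norm y = norm (t *\<^sub>R 1 - x) / t" 
    using t by (metis abs_of_pos divide_inverse_commute norm_scaleR inverse_eq_divide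
        zero_less_divide_1_iff)
  then have "norm y \<le> 1" using t le by simp
  moreover have "star y = y" by (simp add: y_def star_diff star_one star_scaleR sa)
  ultimately obtain w where w: "star w = w" "w * w = 1 - y" "\<And>z. z * y = y * z \<Longrightarrow> z * w = w * z"
    using exists_sqrt_one_minus by blast
  have "star (sqrt t *\<^sub>R w) = sqrt t *\<^sub>R w" by (simp add: star_scaleR w)
  moreover have "(sqrt t *\<^sub>R w) * (sqrt t *\<^sub>R w) = x" using t by (simp add: w y_def)
  moreover have "z * (sqrt t *\<^sub>R w) = (sqrt t *\<^sub>R w) * z" if "z * x = x * z" for z
    using w(3)[of z] that by (simp add: y_def algebra_simps)
  ultimately show ?thesis by blast
qed

section \<open>Positive elements\<close>

definition positive :: "'a::unital_cstar_algebra \<Rightarrow> bool" where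
  "positive x \<longleftrightarrow> (\<exists>h. star h = h \<and> x = h * h)"

lemma star_i_scaleC: "star (\<i> *\<^sub>C x) = - (\<i> *\<^sub>C star (x::'a::unital_cstar_algebra))"
  using scaleC_scaleC[of "complex_of_real (-1)" "\<i>" "star x"]
    scaleC_of_real[of "-1" "\<i> *\<^sub>C star x"]
  by (simp add: star_scaleC)

lemma i_scaleC_mult_self: "(\<i> *\<^sub>C x) * (\<i> *\<^sub>C x) = - (x * (x::'a::unital_cstar_algebra))"
  using scaleC_of_real[of "-1" "x * x"] 
  by (simp add: mult_scaleC_left mult_scaleC_right scaleC_scaleC)

lemma norm_commuting_unitary_le:
  fixes h k :: "'a::unital_cstar_algebra"
  assumes "star h = h" "star k = k" "h * k = k * h" "h * h + k * k = 1"
  shows "norm (h + \<i> *\<^sub>C k) \<le> 1"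
proof (rule norm_isometry_le_one)
  have "star (h + \<i> *\<^sub>C k) * (h + \<i> *\<^sub>C k) = (h - \<i> *\<^sub>C k) * (h + \<i> *\<^sub>C k)"
    using assms by (simp add: star_add star_i_scaleC)
  also have "\<dots> = h * h - (\<i> *\<^sub>C k) * (\<i> *\<^sub>C k) + (h * (\<i> *\<^sub>C k) - (\<i> *\<^sub>C k) * h)"
    by (simp add: algebra_simps)
  also have "\<dots> = 1"
    unfolding i_scaleC_mult_self using assms by (simp add: mult_scaleC_left mult_scaleC_right)
  finally show "star (h + \<i> *\<^sub>C k) * (h + \<i> *\<^sub>C k) = 1" .
qed

lemma norm_real_part_le:
  fixes u :: "'a::unital_cstar_algebra"
  shows "norm ((1/2) *\<^sub>R (u + star u)) \<le> norm u"
  using norm_triangle_ineq[of u "star u"] by (simp add: norm_star)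

text \<open>
  With \<open>k\<close> the root of \<open>1 - h * h\<close>, the element \<open>u = h + \<i> *\<^sub>C k\<close> is unitary, like
  \<open>cos \<theta> + \<i> sin \<theta>\<close>, and the double angle formula identifies the real part of \<open>u * u\<close> with
  \<open>2 *\<^sub>R (h * h) - 1\<close>.
\<close>

lemma norm_half_minus_square:
  fixes h :: "'a::unital_cstar_algebra"
  assumes sa: "star h = h" and le: "norm (h * h) \<le> 1"
  shows "norm ((1/2) *\<^sub>R 1 - h * h) \<le> 1/2"
proof -
  obtain k where k: "star k = k" "k * k = 1 - h * h" "\<And>z. z * (h * h) = (h * h) * z \<Longrightarrow> z * k = k * z"
    using exists_sqrt_one_minus[of "h * h", OF _ le] unfolding star_mult sa by blast
  have hk: "h * k = k * h" by (rule k(3)) (simp add: mult.assoc)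
  define u where "u = h + \<i> *\<^sub>C k"
  have u: "norm u \<le> 1"
    unfolding u_def by (rule norm_commuting_unitary_le) (simp_all add: sa k(1,2) hk)
  have us: "star u = h - \<i> *\<^sub>C k" by (simp add: u_def star_add star_i_scaleC sa k(1))
  have "u * u + star (u * u) = 2 *\<^sub>R (h * h + (\<i> *\<^sub>C k) * (\<i> *\<^sub>C k))"
    unfolding star_mult us unfolding u_def by (simp add: algebra_simps scaleR_2)
  also have "\<dots> = (- 4) *\<^sub>R ((1/2) *\<^sub>R 1 - h * h)"
    unfolding i_scaleC_mult_self k(2) by (simp add: algebra_simps flip: scaleR_left_distrib)
  finally have "(1/2) *\<^sub>R (u * u + star (u * u)) = (- 2) *\<^sub>R ((1/2) *\<^sub>R 1 - h * h)" by simp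
  then have "2 * norm ((1/2) *\<^sub>R 1 - h * h) \<le> norm (u * u)"
    using norm_real_part_le[of "u * u"] by simp
  also have "\<dots> \<le> 1"
    using norm_mult_ineq[of u u] mult_mono[OF u u] by simp
  finally show ?thesis by simp
qed

lemma positive_star: "positive x \<Longrightarrow> star x = x"
  by (auto simp: positive_def star_mult)

lemma positive_square: "star h = h \<Longrightarrow> positive (h * h)"
  by (auto simp: positive_def)

lemma positive_zero: "positive 0"
  using positive_square[of 0] by (simp add: star_zero)

lemma positive_scaleR:
  assumes "positive x" "r \<ge> 0"
  shows "positive (r *\<^sub>R x)"
proof -
  obtain h where "star h = h" "x = h * h" using assms(1) by (auto simp: positive_def)
  then show ?thesis using positive_square[of "sqrt r *\<^sub>R h"] assms(2) by (simp add: star_scaleR)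
qed

lemma positive_one: "positive 1"
  using positive_square[of 1] by (simp add: star_one)

text \<open>
  Together with \<open>positiveI_norm\<close> this characterises positivity by the norm.  That
  \<open>t\<close> is not tied to \<open>norm x\<close> lets the criterion pass to sums and limits.
\<close>

lemma positive_norm_bound:
  fixes x :: "'a::unital_cstar_algebra"
  assumes "positive x" and le: "norm x \<le> t"
  shows "norm (t *\<^sub>R 1 - x) \<le> t"
proof (cases "t = 0")
  case False
  then have t: "t > 0" using le norm_ge_zero[of x] by linarith
  obtain h where h: "star h = h" "x = h * h" using assms(1) by (auto simp: positive_def)
  define g where "g = (1 / sqrt t) *\<^sub>R h"
  have gg: "g * g = (1/t) *\<^sub>R x" using t by (simp add: g_def h(2))
  have "norm ((1/2) *\<^sub>R 1 - g * g) \<le> 1/2"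
    by (rule norm_half_minus_square) (use t le in \<open>simp_all add: g_def star_scaleR h\<close>)
  then have "t * norm ((1/2) *\<^sub>R 1 - g * g) \<le> t/2" using t by simp
  moreover have "t *\<^sub>R ((1/2) *\<^sub>R 1 - g * g) = (t/2) *\<^sub>R 1 - x"
    using t by (simp add: gg algebra_simps)
  ultimately have "norm ((t/2) *\<^sub>R 1 - x) \<le> t/2" using t by (metis abs_of_pos norm_scaleR)
  moreover have "norm ((t/2) *\<^sub>R (1::'a)) \<le> t/2"
    using t norm_one_le[where 'a='a] by simp
  ultimately have "norm ((t/2) *\<^sub>R 1 + ((t/2) *\<^sub>R 1 - x)) \<le> t/2 + t/2"
    by (intro norm_triangle_mono)
  moreover have "(t/2) *\<^sub>R 1 + ((t/2) *\<^sub>R 1 - x) = t *\<^sub>R 1 - x"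
    by (simp add: add_diff_eq flip: scaleR_left_distrib)
  ultimately show ?thesis by simp
qed (use le in simp)

lemma positiveI_norm:
  assumes "star x = x" "norm (t *\<^sub>R 1 - x) \<le> t"
  shows "positive x"
  using exists_sqrt[OF assms] by (auto simp: positive_def)

lemma positive_sqrt:
  assumes "positive x"
  shows "\<exists>w. star w = w \<and> w * w = x \<and> (\<forall>z. z * x = x * z \<longrightarrow> z * w = w * z)"
  using exists_sqrt[OF positive_star[OF assms] positive_norm_bound[OF assms order_refl]] .

lemma positive_add:
  assumes "positive x" "positive y"
  shows "positive (x + y)"
proof (rule positiveI_norm)
  show "star (x + y) = x + y" using assms by (simp add: star_add positive_star)
  have "norm ((norm x *\<^sub>R 1 - x) + (norm y *\<^sub>R 1 - y)) \<le> norm x + norm y"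
    using positive_norm_bound[OF assms(1) order_refl] positive_norm_bound[OF assms(2) order_refl]
    by (rule norm_triangle_mono)
  then show "norm ((norm x + norm y) *\<^sub>R 1 - (x + y)) \<le> norm x + norm y"
    by (simp add: algebra_simps)
qed

lemma positive_sum: "(\<And>i. i \<in> I \<Longrightarrow> positive (f i)) \<Longrightarrow> positive (sum f I)"
  by (induction I rule: infinite_finite_induct) (simp_all add: positive_zero positive_add)

lemma positive_add_scalar: "positive x \<Longrightarrow> r \<ge> 0 \<Longrightarrow> positive (x + r *\<^sub>R 1)"
  by (simp add: positive_add positive_one positive_scaleR)

lemma positive_closed:
  fixes x :: "'a::unital_cstar_algebra"
  assumes "\<And>r. r > 0 \<Longrightarrow> positive (x + r *\<^sub>R 1)"
  shows "positive x"
proof (rule positiveI_norm)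
  have "star (x + 1 *\<^sub>R 1) = x + 1 *\<^sub>R 1" by (rule positive_star[OF assms]) simp
  then show "star x = x" by (simp add: star_add star_one)
  show "norm (norm x *\<^sub>R 1 - x) \<le> norm x"
  proof (rule field_le_epsilon)
    fix r :: real assume r: "r > 0"
    have "norm (r *\<^sub>R (1::'a)) \<le> r" using r norm_one_le[where 'a='a] by simp
    then have "norm (x + r *\<^sub>R 1) \<le> norm x + r"
      using norm_triangle_ineq[of x "r *\<^sub>R 1"] by linarith
    then have "norm ((norm x + r) *\<^sub>R 1 - (x + r *\<^sub>R 1)) \<le> norm x + r"
      by (rule positive_norm_bound[OF assms[OF r]])
    then show "norm (norm x *\<^sub>R 1 - x) \<le> norm x + r" by (simp add: algebra_simps)
  qed
qed

lemma positive_conjugate_commuting: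
  assumes "positive g" "star k = k" "k * g = g * k"
  shows "positive (k * g * k)"
proof -
  obtain w where w: "star w = w" "w * w = g" "k * w = w * k"
    using positive_sqrt[OF assms(1)] assms(3) by blast
  have "k * g * k = (k * w) * (k * w)" by (metis w(2,3) mult.assoc)
  moreover have "star (k * w) = k * w" by (simp add: star_mult w assms(2))
  ultimately show ?thesis by (metis positive_square)
qed

text \<open>
  The roots \<open>k\<close> of \<open>x\<close> and \<open>h\<close> of \<open>1 - x\<close> commute, so \<open>k\<close> is the real part of the unitary
  \<open>k + \<i> *\<^sub>C h\<close>.
\<close>

lemma norm_le_one_of_positive:
  fixes x :: "'a::unital_cstar_algebra"
  assumes "positive x" "positive (1 - x)"
  shows "norm x \<le> 1"
proof -
  obtain k where k: "star k = k" "k * k = x"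
    using positive_sqrt[OF assms(1)] by blast
  have "k * (1 - x) = (1 - x) * k" by (simp add: k(2)[symmetric] algebra_simps)
  then obtain h where h: "star h = h" "h * h = 1 - x" "k * h = h * k"
    using positive_sqrt[OF assms(2)] by blast
  have u: "norm (k + \<i> *\<^sub>C h) \<le> 1"
    by (rule norm_commuting_unitary_le) (simp_all add: k h)
  have "(1/2) *\<^sub>R ((k + \<i> *\<^sub>C h) + star (k + \<i> *\<^sub>C h)) = k"
    by (simp add: star_add star_i_scaleC k h flip: scaleR_2)
  then have "norm k \<le> 1" using norm_real_part_le[of "k + \<i> *\<^sub>C h"] u by simp
  then show ?thesis
    using norm_mult_ineq[of k k] mult_mono[of "norm k" 1 "norm k" 1] k(2) by simp
qed

section \<open>Positivity of \<open>star x * x\<close>\<close>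

lemma exists_inverse_one_minus:
  fixes y :: "'a::unital_cstar_algebra"
  assumes "norm y < 1"
  shows "\<exists>v. mutually_inverse (1 - y) v"
proof -
  have s: "summable (\<lambda>n. y ^ n)"
    by (rule summable_comparison_test'[OF summable_geometric[of "norm y"]])
      (use assms in \<open>simp_all add: norm_power_le\<close>)
  have h: "(\<Sum>n. y ^ Suc n) = (\<Sum>n. y ^ n) - 1" using suminf_split_head[OF s] by simp
  have "y * (\<Sum>n. y ^ n) = (\<Sum>n. y ^ n) - 1"
    using suminf_mult[OF s, of y] h by simp
  moreover have "(\<Sum>n. y ^ n) * y = (\<Sum>n. y ^ n) - 1"
    using suminf_mult2[OF s, of y] h by (simp add: power_commutes)
  ultimately show ?thesis
    unfolding mutually_inverse_def by (intro exI[of _ "\<Sum>n. y ^ n"]) (simp add: algebra_simps)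
qed

text \<open>
  A positive element bounded below by a positive scalar \<open>r\<close> is a multiple of \<open>1 - y\<close> with
  \<open>norm y < 1\<close>; the Neumann series inverts it, and hence its root.
\<close>

lemma positive_invertible_sqrt:
  fixes x :: "'a::unital_cstar_algebra"
  assumes x: "positive x" and r: "r > 0"
  shows "\<exists>k l. star k = k \<and> star l = l \<and> mutually_inverse k l \<and> k * k = x + r *\<^sub>R 1"
proof -
  define t where "t = norm x + r"
  have t: "t > 0" using r by (simp add: t_def add_nonneg_pos)
  define y where "y = (1/t) *\<^sub>R (norm x *\<^sub>R 1 - x)"
  have "norm y \<le> norm x / t"
    using positive_norm_bound[OF x order_refl] t by (simp add: y_def divide_simps)
  also have "\<dots> < 1" using t r by (simp add: t_def)
  finally have "norm y < 1" .
  then obtain v where v: "(1 - y) * v = 1" "v * (1 - y) = 1"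
    using exists_inverse_one_minus by (auto simp: mutually_inverse_def)
  have eq: "x + r *\<^sub>R 1 = t *\<^sub>R (1 - y)"
  proof -
    have "t *\<^sub>R y = norm x *\<^sub>R 1 - x" using t by (simp add: y_def)
    then show ?thesis by (simp add: scaleR_diff_right) (simp add: t_def scaleR_left_distrib)
  qed
  obtain k where k: "star k = k" "k * k = x + r *\<^sub>R 1"
    using positive_sqrt[OF positive_add_scalar[OF x less_imp_le[OF r]]] by blast
  define u where "u = (1/t) *\<^sub>R v"
  have u: "k * (k * u) = 1" "(u * k) * k = 1"
    using t by (simp_all add: u_def eq k(2) v mult.assoc flip: mult.assoc[of k k])
  have "u * k = (u * k) * (k * (k * u))" using u(1) by simp
  also have "\<dots> = k * u" using u(2) by (simp flip: mult.assoc)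
  finally have uk: "u * k = k * u" .
  have "star (k * u) * k = 1"
    using arg_cong[OF u(1), of star] by (simp add: star_mult star_one k(1))
  then have "star (k * u) = k * u" using u(1) by (metis mult.assoc mult_1_left mult_1_right)
  then show ?thesis using k u uk unfolding mutually_inverse_def by metis
qed

text \<open>
  With \<open>p\<close> and \<open>q\<close> the real and imaginary parts of \<open>x\<close>, the sum is \<open>2 *\<^sub>R (p * p + q * q)\<close>.
\<close>

lemma positive_star_mult_sum: "positive (star x * x + x * star x)"
proof -
  define p where "p = (1/2) *\<^sub>R (star x + x)"
  \<comment> \<open>the imaginary part is \<open>\<i> *\<^sub>C d\<close>, with square \<open>- (d * d)\<close>\<close>
  define d where "d = (1/2) *\<^sub>R (star x - x)"
  have "star p = p" by (simp add: p_def star_scaleR star_add star_star add.commute)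
  then have p: "positive (p * p)" by (rule positive_square)
  have "star (\<i> *\<^sub>C d) = \<i> *\<^sub>C d"
  proof -
    have "star d = - d" by (simp add: d_def star_scaleR star_diff star_star algebra_simps)
    then show ?thesis
      using scaleC_scaleC[of "\<i>" "complex_of_real (-1)" d] scaleC_of_real[of "-1" d]
        scaleC_scaleC[of "complex_of_real (-1)" "\<i>" d] scaleC_of_real[of "-1" "\<i> *\<^sub>C d"]
      by (simp add: star_i_scaleC)
  qed
  then have d: "positive (- (d * d))" using positive_square[of "\<i> *\<^sub>C d"] by (simp add: i_scaleC_mult_self)
  have "2 *\<^sub>R (p * p + - (d * d)) = star x * x + x * star x"
    by (simp add: p_def d_def algebra_simps flip: scaleR_left_distrib)
  then show ?thesis using positive_scaleR[OF positive_add[OF p d], of 2] by simp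
qed

text \<open>
  Let \<open>k\<close> and \<open>l\<close> be the roots of \<open>star x * x + r\<close> and \<open>x * star x + r\<close>, with inverses \<open>k'\<close> and
  \<open>l'\<close>.  For \<open>y = x * k'\<close> both \<open>star y * y\<close> and \<open>y * star y\<close> become explicit, namely
  \<open>1 - r *\<^sub>R (k' * k')\<close> and \<open>1 - r *\<^sub>R (l' * l')\<close>.  Their sum is positive, and adding the positive
  \<open>r *\<^sub>R (l' * l')\<close> leaves \<open>r *\<^sub>R (k' * k') \<le> 2\<close>, that is \<open>r \<le> 2 *\<^sub>R (k * k)\<close>.
  Bounds on both products are assumed because both roots are needed; the conclusion for
  \<open>x * star x\<close> follows by exchanging \<open>x\<close> and \<open>star x\<close>.
\<close>

lemma star_mult_lower_bound_improve:
  fixes x :: "'a::unital_cstar_algebra"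
  assumes e: "positive (star x * x + m *\<^sub>R 1)" and f: "positive (x * star x + m *\<^sub>R 1)"
    and r: "0 < r" "m < r"
  shows "positive (star x * x + (r/2) *\<^sub>R 1)"
proof -
  obtain k k' where k: "star k = k" "star k' = k'" "k * k' = 1" "k' * k = 1"
      "k * k = star x * x + r *\<^sub>R 1"
    using positive_invertible_sqrt[OF e, of "r - m"] r
    by (auto simp: mutually_inverse_def algebra_simps simp flip: scaleR_left_distrib)
  obtain l l' where l: "star l = l" "star l' = l'" "l * l' = 1" "l' * l = 1"
      "l * l = x * star x + r *\<^sub>R 1"
    using positive_invertible_sqrt[OF f, of "r - m"] r
    by (auto simp: mutually_inverse_def algebra_simps simp flip: scaleR_left_distrib)
  have kk: "k * k * (k' * k') = 1" "k' * (k * k) * k' = 1" 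
    using k(3,4) by (metis mult.assoc mult_1_left)+
  have ll: "l' * l' * (l * l) = 1"
    using l(3,4) by (metis mult.assoc mult_1_left)
  define y where "y = x * k'"
  have "star y * y = k' * (star x * x) * k'" by (simp add: y_def star_mult k(2) mult.assoc)
  also have "\<dots> = k' * (k * k - r *\<^sub>R 1) * k'" by (simp add: k(5))
  also have "\<dots> = 1 - r *\<^sub>R (k' * k')"
    using kk(2) by (simp add: right_diff_distrib left_diff_distrib)
  finally have 1: "star y * y = 1 - r *\<^sub>R (k' * k')" .
  \<comment> \<open>\<open>x\<close> intertwines \<open>star x * x\<close> and \<open>x * star x\<close>, hence also the inverses of their shifts\<close>
  have "x * (k * k) = (l * l) * x" by (simp add: k(5) l(5) algebra_simps)
  then have "l' * l' * (x * (k * k)) * (k' * k') = l' * l' * ((l * l) * x) * (k' * k')" by simp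
  then have "l' * l' * x * (k * k * (k' * k')) = (l' * l' * (l * l)) * x * (k' * k')"
    by (simp add: mult.assoc)
  then have lx: "l' * l' * x = x * (k' * k')" unfolding kk(1) ll by simp
  have "y * star y = x * (k' * k') * star x" by (simp add: y_def star_mult k(2) mult.assoc)
  also have "\<dots> = l' * l' * (x * star x)" by (simp only: lx[symmetric] mult.assoc)
  also have "\<dots> = l' * l' * (l * l - r *\<^sub>R 1)" by (simp add: l(5))
  also have "\<dots> = 1 - r *\<^sub>R (l' * l')" using ll by (simp add: right_diff_distrib)
  finally have 2: "y * star y = 1 - r *\<^sub>R (l' * l')" .
  have "positive ((star y * y + y * star y) + r *\<^sub>R (l' * l'))"
    using r by (intro positive_add positive_star_mult_sum positive_scaleR positive_square l) simp
  moreover have "(star y * y + y * star y) + r *\<^sub>R (l' * l') = 2 *\<^sub>R 1 - r *\<^sub>R (k' * k')"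
    unfolding 1 2 by (simp add: algebra_simps scaleR_2)
  ultimately have g: "positive (2 *\<^sub>R 1 - r *\<^sub>R (k' * k'))" by simp
  have c: "k * (k' * k') = (k' * k') * k" using k(3,4) by (metis mult.assoc mult_1_left mult_1_right)
  have "positive (k * (2 *\<^sub>R 1 - r *\<^sub>R (k' * k')) * k)"
    by (rule positive_conjugate_commuting[OF g k(1)])
      (simp add: right_diff_distrib left_diff_distrib c)
  moreover have "k * (2 *\<^sub>R 1 - r *\<^sub>R (k' * k')) * k = 2 *\<^sub>R (k * k) - r *\<^sub>R 1"
  proof -
    have "k * (k' * k') * k = 1" using k(3,4) by (metis mult.assoc mult_1_left)
    then show ?thesis by (simp add: right_diff_distrib left_diff_distrib)
  qed
  moreover have "2 *\<^sub>R (k * k) - r *\<^sub>R 1 = 2 *\<^sub>R (star x * x + (r/2) *\<^sub>R 1)"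
    unfolding k(5) by (simp add: scaleR_2 scaleR_left_distrib[symmetric] algebra_simps)
  ultimately have "positive (2 *\<^sub>R (star x * x + (r/2) *\<^sub>R 1))" by simp
  then show ?thesis using positive_scaleR[of "2 *\<^sub>R (star x * x + (r/2) *\<^sub>R 1)" "1/2"] by simp
qed

text \<open>
  Starting from the trivial lower bound \<open>- M\<close>, each application of
  \<open>star_mult_lower_bound_improve\<close> with \<open>r = 3/2 * m\<close> shrinks the bound by the factor \<open>3/4\<close>.
\<close>

theorem positive_star_mult: "positive (star x * (x::'a::unital_cstar_algebra))"
proof (rule positive_closed)
  fix r :: real assume r: "r > 0"
  define M where "M = (norm x)\<^sup>2 + 1"
  have M: "M > 0" unfolding M_def by (simp add: add_nonneg_pos)
  have start: "positive (star z * z + M *\<^sub>R 1)" if "norm z = norm x" for z :: 'a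
  proof (rule positiveI_norm)
    show "star (star z * z + M *\<^sub>R 1) = star z * z + M *\<^sub>R 1"
      by (simp add: star_add star_mult star_star star_scaleR star_one)
    show "norm (M *\<^sub>R 1 - (star z * z + M *\<^sub>R 1)) \<le> M"
      using that by (simp add: cstar_identity M_def)
  qed
  have *: "positive (star x * x + (M * (3/4) ^ n) *\<^sub>R 1) \<and> positive (x * star x + (M * (3/4) ^ n) *\<^sub>R 1)"
    for n
  proof (induction n)
    case 0
    show ?case using start[of x] start[of "star x"] by (simp add: norm_star star_star)
  next
    case (Suc n)
    let ?m = "M * (3/4) ^ n" and ?r = "M * (3/4) ^ n * (3/2)"
    have "0 < ?r" "?m < ?r" using M by simp_all
    then show ?case
      using star_mult_lower_bound_improve[of x ?m ?r] star_mult_lower_bound_improve[of "star x" ?m ?r] Suc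
      by (simp add: star_star mult_ac)
  qed
  obtain n where "(3/4) ^ n < r / M"
    using real_arch_pow_inv[of "r / M" "3/4"] r M by auto
  then have n: "r - M * (3/4) ^ n \<ge> 0" using M by (simp add: field_simps)
  show "positive (star x * x + r *\<^sub>R 1)"
    using positive_add_scalar[OF conjunct1[OF *[of n]] n] by (simp add: algebra_simps)
qed

lemma positive_conjugate:
  assumes "positive g"
  shows "positive (star z * g * z)"
proof -
  obtain h where "star h = h" "g = h * h" using assms by (auto simp: positive_def)
  then show ?thesis using positive_star_mult[of "h * z"] by (simp add: star_mult mult.assoc)
qed

section \<open>Simultaneous similarity\<close>

text \<open>
  Conjugating \<open>star x * (c * c) * x \<le> c * c\<close> by the inverse \<open>d\<close> of \<open>c\<close> yields
  \<open>star z * z \<le> 1\<close> for \<open>z = c * x * d\<close>.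
\<close>

lemma contraction_of_positive:
  fixes x :: "'a::unital_cstar_algebra"
  assumes c: "star c = c" "star d = d" "mutually_inverse c d"
    and pos: "positive (c * c - star x * (c * c) * x)"
  shows "norm (c * x * d) \<le> 1"
proof -
  have cd: "c * d = 1" "d * c = 1" using c(3) by (auto simp: mutually_inverse_def)
  define z where "z = c * x * d"
  have "star d * (c * c - star x * (c * c) * x) * d
      = (d * c) * (c * d) - star z * z"
    by (simp add: z_def star_mult c(1,2) algebra_simps)
  then have "positive (1 - star z * z)"
    using positive_conjugate[OF pos, of d] by (simp add: cd)
  then have "norm (star z * z) \<le> 1"
    by (rule norm_le_one_of_positive[OF positive_star_mult])
  then have "(norm z)\<^sup>2 \<le> 1\<^sup>2" by (simp add: cstar_identity)
  then show ?thesis unfolding z_def by (rule power2_le_imp_le) simp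
qed

lemma positive_one_minus_star_mult:
  fixes x :: "'a::unital_cstar_algebra"
  assumes "norm x \<le> 1"
  shows "positive (1 - star x * x)"
  by (rule positiveI_norm[where t = 1])
    (use assms in \<open>simp_all add: star_diff star_one star_mult star_star cstar_identity power_le_one\<close>)

text \<open>
  On a Hilbert space on which the algebra acts, \<open>p\<close> defines the equivalent norm whose square is
  \<open>\<Sum>n<N. \<parallel>a ^ n \<xi>\<parallel>\<^sup>2\<close>.  It does not increase under \<open>a\<close> because the sum is shifted and
  \<open>a ^ N\<close> is a contraction, and under \<open>b\<close> because the contraction \<open>b\<close> can be
  moved past every \<open>a ^ n\<close>.
\<close>

lemma simultaneous_contraction:
  fixes a b :: "'a::unital_cstar_algebra"
  assumes ab: "a * b = b * a" and b: "norm b \<le> 1" and N: "N > 0" "norm (a ^ N) \<le> 1"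
  shows "\<exists>c d. mutually_inverse c d \<and> norm (c * a * d) \<le> 1 \<and> norm (c * b * d) \<le> 1"
proof -
  define T where "T n = star (a ^ n) * a ^ n" for n
  define p where "p = (\<Sum>n<N. T n)"
  obtain M where M: "N = Suc M" using N(1) by (cases N) auto
  \<comment> \<open>the term for \<open>n = 0\<close> is what makes \<open>p\<close> invertible\<close>
  have p: "p = (\<Sum>n<M. T (Suc n)) + 1 *\<^sub>R 1"
    unfolding p_def M by (subst sum.lessThan_Suc_shift) (simp add: T_def star_one add.commute)
  have "positive (\<Sum>n<M. T (Suc n))"
    by (rule positive_sum) (simp add: T_def positive_star_mult del: power_Suc)
  then obtain c d where c: "star c = c" "star d = d" "mutually_inverse c d" "c * c = p"
    unfolding p using positive_invertible_sqrt[of _ 1] by force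
  have Ta: "star a * T n * a = T (Suc n)" for n
    unfolding T_def power_Suc2 star_mult by (simp only: mult.assoc)
  have "star a * p * a = (\<Sum>n<N. T (Suc n))"
    by (simp add: p_def sum_distrib_left sum_distrib_right Ta)
  also have "\<dots> = p - T 0 + T N"
    using sum.lessThan_Suc_shift[of T N] sum.lessThan_Suc[of T N] by (simp add: p_def algebra_simps)
  finally have "p - star a * p * a = 1 - star (a ^ N) * a ^ N" by (simp add: T_def star_one)
  then have A: "norm (c * a * d) \<le> 1"
    using positive_one_minus_star_mult[OF N(2)] contraction_of_positive[OF c(1-3)] c(4) by simp
  have Tb: "T n - star b * T n * b = star (a ^ n) * (1 - star b * b) * a ^ n" for n
  proof -
    have "a ^ n * b = b * a ^ n" by (metis ab power_commuting_commutes)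
    then have "star b * star (a ^ n) * (a ^ n * b) = star (a ^ n) * star b * (b * a ^ n)"
      by (metis star_mult)
    then show ?thesis by (simp add: T_def algebra_simps)
  qed
  have "p - star b * p * b = (\<Sum>n<N. star (a ^ n) * (1 - star b * b) * a ^ n)"
    by (simp add: p_def sum_distrib_left sum_distrib_right flip: Tb sum_subtractf)
  moreover have "positive \<dots>"
    by (intro positive_sum positive_conjugate positive_one_minus_star_mult b)
  ultimately have B: "norm (c * b * d) \<le> 1"
    using contraction_of_positive[OF c(1-3)] c(4) by simp
  show ?thesis using A B c(3) by blast
qed

lemma mutually_inverse_mult:
  assumes "mutually_inverse s t" "mutually_inverse u v"
  shows "mutually_inverse (s * u) (v * t)"
  using assms unfolding mutually_inverse_def by (metis mult.assoc mult_1_left)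

lemma mutually_inverse_sym: "mutually_inverse s t \<Longrightarrow> mutually_inverse t s"
  by (simp add: mutually_inverse_def)

lemma conjugate_power:
  assumes "mutually_inverse s t"
  shows "(s * x * t) ^ n = s * x ^ n * t"
proof (induction n)
  case 0
  then show ?case using assms by (simp add: mutually_inverse_def)
next
  case (Suc n)
  have "(s * x * t) ^ Suc n = s * x * (t * s) * x ^ n * t" 
    using Suc by (simp add: mult.assoc)
  also have "\<dots> = s * x ^ Suc n * t" using assms by (simp add: mutually_inverse_def mult.assoc)
  finally show ?case .
qed

lemma power_norm_le_one_of_similar:
  fixes a :: "'a::unital_cstar_algebra"
  assumes "similar_to_strict_contraction a"
  shows "\<exists>N>0. norm (a ^ N) \<le> 1"
proof -
  obtain s t where st: "mutually_inverse s t" and lt: "norm (s * a * t) < 1"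
    using assms by (auto simp: similar_to_strict_contraction_def)
  define q where "q = s * a * t"
  define K where "K = norm t * norm s"
  have "(\<lambda>n. K * norm q ^ n) \<longlonglongrightarrow> K * 0"
    using lt by (intro tendsto_intros LIMSEQ_power_zero) (simp add: q_def)
  then have "eventually (\<lambda>n. K * norm q ^ n < 1) sequentially"
    by (intro order_tendstoD(2)[of _ "K * 0"]) simp_all
  then obtain N where N: "N > 0" "K * norm q ^ N < 1"
    by (auto simp: eventually_sequentially) (metis le_SucI order_refl zero_less_Suc)
  have "a = t * q * s"
    using st unfolding q_def mutually_inverse_def by (metis mult.assoc mult_1_left mult_1_right)
  then have "a ^ N = t * q ^ N * s"
    using conjugate_power[OF mutually_inverse_sym[OF st]] by simp
  then have "norm (a ^ N) \<le> norm (t * q ^ N) * norm s" by (simp add: norm_mult_ineq)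
  also have "\<dots> \<le> (norm t * norm (q ^ N)) * norm s"
    by (intro mult_right_mono norm_mult_ineq) simp
  also have "\<dots> \<le> (norm t * norm q ^ N) * norm s"
    by (intro mult_right_mono mult_left_mono norm_power_le) simp_all
  also have "\<dots> \<le> 1" using N(2) by (simp add: K_def mult_ac)
  finally show ?thesis using N(1) by blast
qed

text \<open>
  After conjugation by the element that makes \<open>b\<close> a contraction, \<open>a\<close> is still similar to a strict
  contraction, and the conjugates still commute.
\<close>

theorem theorem17:
  fixes a b :: "'a::unital_cstar_algebra"
  assumes "a * b = b * a"
    and "similar_to_strict_contraction a"
    and "similar_to_contraction b"
  shows "\<exists>c d. mutually_inverse c d \<and> norm (c * a * d) \<le> 1 \<and> norm (c * b * d) \<le> 1"
proof -
  obtain s t where st: "mutually_inverse s t" and b: "norm (s * b * t) \<le> 1"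
    using assms(3) by (auto simp: similar_to_contraction_def)
  obtain s' t' where st': "mutually_inverse s' t'" and a: "norm (s' * a * t') < 1"
    using assms(2) by (auto simp: similar_to_strict_contraction_def)
  have ts: "t * s = 1" using st by (simp add: mutually_inverse_def)
  have cancel: "t * (s * z) = z" for z using ts by (metis mult.assoc mult_1_left)
  have "mutually_inverse (s' * t) (s * t')"
    by (rule mutually_inverse_mult[OF st' mutually_inverse_sym[OF st]])
  moreover have "(s' * t) * (s * a * t) * (s * t') = s' * a * t'"
    by (simp add: mult.assoc cancel)
  ultimately have "similar_to_strict_contraction (s * a * t)"
    unfolding similar_to_strict_contraction_def using a by metis
  then obtain N where "N > 0" "norm ((s * a * t) ^ N) \<le> 1"
    using power_norm_le_one_of_similar by blast
  moreover have "(s * a * t) * (s * b * t) = (s * b * t) * (s * a * t)"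
  proof -
    have "(s * x * t) * (s * y * t) = s * (x * y) * t" for x y
      by (simp add: mult.assoc cancel)
    then show ?thesis by (simp add: assms(1))
  qed
  ultimately obtain c d where "mutually_inverse c d" "norm (c * (s * a * t) * d) \<le> 1"
      "norm (c * (s * b * t) * d) \<le> 1"
    using simultaneous_contraction b by blast
  then have "mutually_inverse (c * s) (t * d)" "norm ((c * s) * a * (t * d)) \<le> 1"
      "norm ((c * s) * b * (t * d)) \<le> 1"
    by (simp_all add: mutually_inverse_mult st mult.assoc)
  then show ?thesis by blast
qed

end
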